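(* Let $f \in C^{\infty}(\mathbb{R})$ (complex-valued), and suppose that for all $\varepsilon > 0$ and $m \in \mathbb{Z}_+$ there exists a number $d_{\varepsilon,m} > 0$ such that for each $n \in \mathbb{Z}_+$ $$(1+|x|)^m |f^{(n)}(x)| \le d_{\varepsilon,m} (\sigma+\varepsilon)^n\, n!\, e^{-\psi^*(n)}, \quad x \in \mathbb{R}.$$ Then $f$ admits a (unique) extension to an entire function on $\mathbb{C}$ belonging to $S_{\sigma}(\varphi)$.
   Context: $\mathbb{Z}_+ = \{0,1,2,\dots\}$. Fix a real number $\sigma > 0$ and a nonnegative nondecreasing continuous function $\varphi$ on $[0,\infty)$ such that: (1) $\lim_{x\to+\infty} \varphi(x)/x = +\infty$; (2) for every $h > 1$ there exists $K_h > 0$ such that $2\varphi(x) \le \varphi(hx) + K_h$ for all $x \in [0,\infty)$; (3) the function $x \mapsto \varphi(e^x)$ is convex on $[0,\infty)$. For $\varepsilon > 0$ and $k \in \mathbb{Z}_+$, $S_{\varepsilon,k}(\varphi)$ is the set of entire functions $f$ on $\mathbb{C}$ with $$p_{\varepsilon,k}(f) = \sup_{z\in\mathbb{C}} \frac{|f(z)|(1+|z|)^k}{e^{\varphi((\sigma+\varepsilon)|\mathrm{Im}\, z|)}} < \infty,$$ and $S_{\sigma}(\varphi) = \bigcap_{\varepsilon>0,\,k\in\mathbb{Z}_+} S_{\varepsilon,k}(\varphi)$. Let $\psi(x) = \varphi(e^x)$. Its Young conjugate is $\psi^*(x) = \sup_{y>0}(xy - \psi(y))$, $x \ge 0$ (only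 $y>0$ is used). *)

theory Defs
  imports "HOL-Complex_Analysis.Complex_Analysis"
begin

definition nth_deriv :: "nat \<Rightarrow> (real \<Rightarrow> complex) \<Rightarrow> real \<Rightarrow> complex" where
  "nth_deriv n f = ((\<lambda>g x. vector_derivative g (at x)) ^^ n) f"

(* Continuity of each derivative follows from differentiability at the next order. *)
definition smooth :: "(real \<Rightarrow> complex) \<Rightarrow> bool" where
  "smooth f \<longleftrightarrow> (\<forall>n x. nth_deriv n f differentiable at x)"

(* The supremum is extended-real valued, so that its finiteness is a genuine condition. *)
definition weighted_norm ::
    "real \<Rightarrow> (real \<Rightarrow> real) \<Rightarrow> real \<Rightarrow> nat \<Rightarrow> (complex \<Rightarrow> complex) \<Rightarrow> ereal" where
  "weighted_norm \<sigma> \<phi> \<epsilon> k f =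
     (SUP z. ereal (cmod (f z) * (1 + cmod z) ^ k / exp (\<phi> ((\<sigma> + \<epsilon>) * \<bar>Im z\<bar>))))"

definition S_space_step ::
    "real \<Rightarrow> (real \<Rightarrow> real) \<Rightarrow> real \<Rightarrow> nat \<Rightarrow> (complex \<Rightarrow> complex) set" where
  "S_space_step \<sigma> \<phi> \<epsilon> k = {f. f holomorphic_on UNIV \<and> weighted_norm \<sigma> \<phi> \<epsilon> k f < \<infinity>}"

definition S_space :: "real \<Rightarrow> (real \<Rightarrow> real) \<Rightarrow> (complex \<Rightarrow> complex) set" where
  "S_space \<sigma> \<phi> = (\<Inter>\<epsilon>\<in>{0<..}. \<Inter>k. S_space_step \<sigma> \<phi> \<epsilon> k)"

(* The supremum ranges over y > 0 only.  It is taken in the reals, hence meaningful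
   only where the set is bounded above; see bdd_above_young_conjugate. *)
definition young_conjugate :: "(real \<Rightarrow> real) \<Rightarrow> real \<Rightarrow> real" where
  "young_conjugate \<psi> x = (SUP y\<in>{0<..}. x * y - \<psi> y)"

lemma bdd_above_young_conjugate:
  fixes \<phi> :: "real \<Rightarrow> real"
  assumes nonneg: "\<And>t. t \<ge> 0 \<Longrightarrow> \<phi> t \<ge> 0"
    and lim: "filterlim (\<lambda>t. \<phi> t / t) at_top at_top"
    and x: "x \<ge> 0"
  shows "bdd_above ((\<lambda>y. x * y - \<phi> (exp y)) ` {0<..})"
proof -
  from lim have "\<forall>\<^sub>F t in at_top. \<phi> t / t \<ge> x"
    by (simp add: filterlim_at_top)
  then obtain T where T: "\<And>t. t \<ge> T \<Longrightarrow> \<phi> t / t \<ge> x"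
    by (auto simp: eventually_at_top_linorder)
  have "x * y - \<phi> (exp y) \<le> x * \<bar>T\<bar>" if y: "y > 0" for y
  proof (cases "exp y \<ge> T")
    case True
    then have "x * exp y \<le> \<phi> (exp y)"
      using T[of "exp y"] by (simp add: field_simps)
    moreover have "y \<le> exp y"
      using exp_ge_add_one_self[of y] by linarith
    then have "x * y \<le> x * exp y"
      using x by (rule mult_left_mono)
    moreover have "0 \<le> x * \<bar>T\<bar>"
      using x by simp
    ultimately show ?thesis by linarith
  next
    case False
    then have "y \<le> \<bar>T\<bar>"
      using exp_ge_add_one_self[of y] by linarith
    then have "x * y \<le> x * \<bar>T\<bar>"
      using x by (rule mult_left_mono)
    moreover have "0 \<le> \<phi> (exp y)"
      by (simp add: nonneg)
    ultimately show ?thesis by linarith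
  qed
  then show ?thesis
    by (auto simp: bdd_above_def)
qed

end

theory Submission
  imports Defs
begin

text \<open>
Young's inequality \<open>n ln r \<le> \<psi>\<^sup>*(n) + \<phi>(r)\<close> says that \<open>exp (- \<psi>\<^sup>*(n)) \<le> exp (\<phi>(r)) / r\<^sup>n\<close> for every \<open>r > 1\<close>
(\<open>exp_minus_young_conjugate_le\<close>). So the derivative bounds are Cauchy estimates read backwards,
with the radius \<open>r\<close> free to be chosen.

Choosing \<open>r\<close> large shows that \<open>D\<^sup>n f(x) / n!\<close> decays, uniformly in \<open>x\<close>, faster than any geometric
sequence. The Taylor series of \<open>f\<close> at every real point \<open>a\<close> therefore defines an entire function
\<open>F\<^sub>a\<close> that agrees with \<open>f\<close> on the whole real line, and by the identity theorem
(\<open>entire_eq_if_eq_on_reals\<close>) all the \<open>F\<^sub>a\<close> are one function \<open>F\<close>. This is what makes the growth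
estimate easy (\<open>smooth_entire_extension_with_Taylor_series\<close>): at \<open>z = x + iy\<close> the function may be
expanded around \<open>x\<close> itself, \<open>F(z) = (\<Sum>n. D\<^sup>n f(x) (iy)\<^sup>n / n!)\<close>, so that the decay of the derivatives
in \<open>x\<close> passes directly to \<open>F\<close> and only powers of \<open>y\<close> remain to be summed.

Taking \<open>r\<close> just above \<open>\<sigma>|y|\<close> turns that sum into a convergent geometric series times
\<open>exp (\<phi>(r))\<close> (\<open>sums_bounded_by_exp_weight\<close>). The remaining factor \<open>(1 + |y|)\<^sup>k\<close> of the weight is at most
a constant times another \<open>exp (\<phi>(r))\<close>, as \<open>\<phi>\<close> grows faster than linearly (\<open>power_le_exp_superlinear\<close>),
and the doubling condition \<open>2\<phi>(x) \<le> \<phi>(hx) + K\<close> absorbs the squared exponential at the price of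
an arbitrarily small dilation of the argument.
\<close>

section \<open>Entire extension of a smooth function by its Taylor series\<close>

lemma nth_deriv_0: "nth_deriv 0 f = f"
  by (simp add: nth_deriv_def)

lemma smooth_has_vector_derivative_nth_deriv:
  assumes "smooth f"
  shows "(nth_deriv n f has_vector_derivative nth_deriv (Suc n) f x) (at x)"
  using assms unfolding smooth_def
  by (metis vector_derivative_works nth_deriv_def comp_apply funpow.simps(2))

text \<open>
The bound \<open>M\<close> is uniform in \<open>t\<close>, so that it controls the Lagrange remainder without any
knowledge of the intermediate point.
\<close>

lemma Maclaurin_sums_of_remainder_tendsto_0:
  fixes diff :: "nat \<Rightarrow> real \<Rightarrow> real"
  assumes deriv: "\<And>n t. (diff n has_real_derivative diff (Suc n) t) (at t)"
    and bound: "\<And>n t. \<bar>diff n t\<bar> / fact n * \<bar>h\<bar> ^ n \<le> M n"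
    and lim: "M \<longlonglongrightarrow> 0"
  shows "(\<lambda>n. diff n 0 / fact n * h ^ n) sums diff 0 h"
proof -
  have "\<bar>(\<Sum>i<n. diff i 0 / fact i * h ^ i) - diff 0 h\<bar> \<le> M n" for n
  proof -
    obtain t where "diff 0 h = (\<Sum>i<n. diff i 0 / fact i * h ^ i) + diff n t / fact n * h ^ n"
      using Maclaurin_bi_le[of diff "diff 0" n h] deriv by blast
    then have "\<bar>(\<Sum>i<n. diff i 0 / fact i * h ^ i) - diff 0 h\<bar> = \<bar>diff n t\<bar> / fact n * \<bar>h\<bar> ^ n"
      by (simp add: abs_mult power_abs)
    with bound show ?thesis by simp
  qed
  then have "(\<lambda>n. (\<Sum>i<n. diff i 0 / fact i * h ^ i) - diff 0 h) \<longlonglongrightarrow> 0"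
    by (intro Lim_null_comparison[OF _ lim] always_eventually) simp
  then show ?thesis
    unfolding sums_def by (rule LIM_zero_cancel)
qed

lemma entire_eq_if_eq_on_reals:
  fixes F G :: "complex \<Rightarrow> complex"
  assumes "F holomorphic_on UNIV" and "G holomorphic_on UNIV"
    and eq: "\<And>x. F (complex_of_real x) = G (complex_of_real x)"
  shows "F = G"
proof
  fix w
  have lim: "(0::complex) islimpt range complex_of_real"
    unfolding islimpt_approachable
  proof (intro allI impI)
    fix e :: real assume "e > 0"
    then show "\<exists>x'\<in>range complex_of_real. x' \<noteq> 0 \<and> dist x' 0 < e"
      by (intro bexI[OF _ rangeI[of complex_of_real "e/2"]]) auto
  qed
  have "F w - G w = 0"
    by (rule analytic_continuation[of "\<lambda>z. F z - G z" UNIV "range complex_of_real" 0])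
       (use assms lim in \<open>auto intro!: holomorphic_intros\<close>)
  then show "F w = G w" by simp
qed

text \<open>
The bound, uniform in \<open>x\<close> and available for every radius \<open>R\<close>, does two jobs: it makes each Taylor
series converge in the whole plane, and it forces the remainders of \<open>Re f\<close> and \<open>Im f\<close> to zero.
The sum of the series at \<open>a\<close> hence restricts to \<open>f\<close> on the real line for every \<open>a\<close>, and the
identity theorem makes it independent of \<open>a\<close>.
\<close>

lemma smooth_entire_extension_with_Taylor_series:
  assumes f: "smooth f"
    and bound: "\<And>R. R > 0 \<Longrightarrow> \<exists>C. \<forall>n x. cmod (nth_deriv n f x) * R ^ n \<le> C * fact n"
  shows "\<exists>F. F holomorphic_on UNIV \<and>
    (\<forall>a z. (\<lambda>n. nth_deriv n f a / fact n * (z - complex_of_real a) ^ n) sums F z)"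
proof -
  \<comment> \<open>Doubling the radius produces the geometric factor; the summand 1 keeps it positive for \<open>\<rho> = 0\<close>.\<close>
  have ex: "\<exists>C. \<forall>n x. cmod (nth_deriv n f x) / fact n * \<rho> ^ n \<le> C * (1/2) ^ n"
    if \<rho>: "\<rho> \<ge> 0" for \<rho>
  proof -
    obtain C where C: "\<And>n x. cmod (nth_deriv n f x) * (2 * \<rho> + 1) ^ n \<le> C * fact n"
      using bound[of "2 * \<rho> + 1"] \<rho> by (auto simp: add_nonneg_pos)
    have "cmod (nth_deriv n f x) / fact n * \<rho> ^ n \<le> C * (1/2) ^ n" for n x
    proof -
      have "cmod (nth_deriv n f x) * (2 * \<rho>) ^ n \<le> cmod (nth_deriv n f x) * (2 * \<rho> + 1) ^ n"
        using \<rho> by (intro mult_left_mono power_mono) auto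
      also note C[of n x]
      finally show ?thesis by (simp add: field_simps power_mult_distrib)
    qed
    then show ?thesis by blast
  qed
  define T where "T = (\<lambda>a z. \<Sum>n. nth_deriv n f a / fact n * (z - complex_of_real a) ^ n)"
  have T: "(\<lambda>n. nth_deriv n f a / fact n * (z - complex_of_real a) ^ n) sums T a z" for a z
  proof -
    obtain C where C: "\<And>n x. cmod (nth_deriv n f x) / fact n * cmod (z - complex_of_real a) ^ n \<le> C * (1/2) ^ n"
      using ex[of "cmod (z - complex_of_real a)"] by auto
    have "summable (\<lambda>n. nth_deriv n f a / fact n * (z - complex_of_real a) ^ n)"
      by (rule summable_comparison_test'[of "\<lambda>n. C * (1/2) ^ n" 0])
         (use C in \<open>auto simp: norm_mult norm_divide norm_power\<close>)
    then show ?thesis unfolding T_def by (rule summable_sums)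
  qed
  have hol: "T a holomorphic_on UNIV" for a
  proof -
    have "T a field_differentiable at w" for w
    proof -
      have "T a holomorphic_on ball (complex_of_real a) (dist (complex_of_real a) w + 1)"
        using T by (rule power_series_holomorphic)
      then show ?thesis
        by (rule holomorphic_on_imp_differentiable_at) auto
    qed
    then show ?thesis
      by (simp add: holomorphic_on_def field_differentiable_at_within)
  qed
  have real: "T a (complex_of_real x) = f x" for a x
  proof -
    define h where "h = x - a"
    obtain C where C: "\<And>n x. cmod (nth_deriv n f x) / fact n * \<bar>h\<bar> ^ n \<le> C * (1/2) ^ n"
      using ex[of "\<bar>h\<bar>"] by auto
    have lim: "(\<lambda>n. C * (1/2) ^ n) \<longlonglongrightarrow> 0"
      by (intro tendsto_mult_right_zero LIMSEQ_power_zero) simp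
    have deriv: "((\<lambda>t. nth_deriv n f (a + t)) has_vector_derivative nth_deriv (Suc n) f (a + t)) (at t)" for n t
    proof -
      have "((\<lambda>t. a + t) has_vector_derivative 1) (at t)"
        by (auto intro!: derivative_eq_intros)
      from vector_diff_chain_at[OF this smooth_has_vector_derivative_nth_deriv[OF f]]
      show ?thesis by (simp add: o_def)
    qed
    have remainder:
      "\<bar>Re (nth_deriv n f (a + t))\<bar> / fact n * \<bar>h\<bar> ^ n \<le> C * (1/2) ^ n"
      "\<bar>Im (nth_deriv n f (a + t))\<bar> / fact n * \<bar>h\<bar> ^ n \<le> C * (1/2) ^ n" for n t
      by (rule order_trans[OF _ C[of n "a + t"]],
          intro mult_right_mono divide_right_mono abs_Re_le_cmod abs_Im_le_cmod; simp)+
    have "(\<lambda>n. Re (nth_deriv n f (a + 0)) / fact n * h ^ n) sums Re (nth_deriv 0 f (a + h))"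
      by (rule Maclaurin_sums_of_remainder_tendsto_0[OF _ _ lim])
         (use deriv remainder(1) in \<open>simp_all add: has_vector_derivative_complex_iff\<close>)
    moreover have "(\<lambda>n. Im (nth_deriv n f (a + 0)) / fact n * h ^ n) sums Im (nth_deriv 0 f (a + h))"
      by (rule Maclaurin_sums_of_remainder_tendsto_0[OF _ _ lim])
         (use deriv remainder(2) in \<open>simp_all add: has_vector_derivative_complex_iff\<close>)
    moreover have scaled: "nth_deriv n f a / fact n * (complex_of_real x - complex_of_real a) ^ n
        = complex_of_real (h ^ n / fact n) * nth_deriv n f a" for n
      by (simp add: h_def)
    have "Re (nth_deriv n f a / fact n * (complex_of_real x - complex_of_real a) ^ n)
          = Re (nth_deriv n f (a + 0)) / fact n * h ^ n"
        "Im (nth_deriv n f a / fact n * (complex_of_real x - complex_of_real a) ^ n)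
          = Im (nth_deriv n f (a + 0)) / fact n * h ^ n" for n
      unfolding scaled by (simp_all del: of_real_power of_real_divide)
    moreover have "nth_deriv 0 f (a + h) = f x"
      by (simp add: nth_deriv_0 h_def)
    ultimately have "(\<lambda>n. nth_deriv n f a / fact n * (complex_of_real x - complex_of_real a) ^ n) sums f x"
      by (simp only: sums_complex_iff)
    with T show ?thesis by (rule sums_unique2)
  qed
  have "T a = T 0" for a
    by (rule entire_eq_if_eq_on_reals) (auto simp: hol real)
  then show ?thesis using hol T by metis
qed

section \<open>Estimates for the weight\<close>

text \<open>
Young's inequality at the point \<open>y = ln r\<close>, exponentiated. The condition \<open>r > 1\<close> is the
restriction \<open>y > 0\<close> in the supremum that defines the conjugate.
\<close>

lemma exp_minus_young_conjugate_le:
  fixes \<phi> :: "real \<Rightarrow> real"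
  assumes "\<And>t. t \<ge> 0 \<Longrightarrow> \<phi> t \<ge> 0"
    and "filterlim (\<lambda>t. \<phi> t / t) at_top at_top"
    and r: "r > 1"
  shows "exp (- young_conjugate (\<lambda>y. \<phi> (exp y)) (real n)) \<le> exp (\<phi> r) / r ^ n"
proof -
  have "real n * ln r - \<phi> (exp (ln r)) \<le> young_conjugate (\<lambda>y. \<phi> (exp y)) (real n)"
    unfolding young_conjugate_def
    by (intro cSUP_upper bdd_above_young_conjugate assms) (use r in auto)
  then have "exp (- young_conjugate (\<lambda>y. \<phi> (exp y)) (real n)) \<le> exp (\<phi> r - real n * ln r)"
    using r by simp
  also have "\<dots> = exp (\<phi> r) / r ^ n"
    using r by (simp add: exp_diff exp_of_nat_mult)
  finally show ?thesis .
qed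

lemma power_le_exp_superlinear:
  fixes \<phi> :: "real \<Rightarrow> real"
  assumes nonneg: "\<And>t. t \<ge> 0 \<Longrightarrow> \<phi> t \<ge> 0"
    and lim: "filterlim (\<lambda>t. \<phi> t / t) at_top at_top"
    and s: "s > 0"
  shows "\<exists>C>0. \<forall>y\<ge>0. (1 + y) ^ k \<le> C * exp (\<phi> (s * y))"
proof -
  \<comment> \<open>This slope turns \<open>\<phi> t \<ge> c t - const\<close> at \<open>t = s y\<close> into \<open>\<phi> (s y) \<ge> k y - const\<close>,
    and \<open>(1 + y) ^ k \<le> exp (k y)\<close>.\<close>
  define c where "c = real k / s"
  have "\<forall>\<^sub>F t in at_top. \<phi> t / t \<ge> c"
    using lim by (simp add: filterlim_at_top)
  then obtain T where T: "\<And>t. t \<ge> T \<Longrightarrow> \<phi> t / t \<ge> c"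
    by (auto simp: eventually_at_top_linorder)
  have c: "c \<ge> 0" using s by (simp add: c_def)
  have low: "c * t - c * \<bar>T\<bar> \<le> \<phi> t" if "t \<ge> 0" for t
  proof (cases "t > \<bar>T\<bar>")
    case True
    then have "c * t \<le> \<phi> t" using T[of t] by (simp add: field_simps)
    then show ?thesis using c by (smt (verit) mult_nonneg_nonneg)
  next
    case False
    then have "c * t \<le> c * \<bar>T\<bar>" using c by (intro mult_left_mono) auto
    then show ?thesis using nonneg[OF that] by linarith
  qed
  have "(1 + y) ^ k \<le> exp (c * \<bar>T\<bar>) * exp (\<phi> (s * y))" if "y \<ge> 0" for y
  proof -
    have "(1 + y) ^ k \<le> exp y ^ k"
      using that by (intro power_mono exp_ge_add_one_self) auto
    also have "\<dots> = exp (c * (s * y))"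
      using s by (simp add: c_def exp_of_nat_mult)
    also have "\<dots> \<le> exp (c * \<bar>T\<bar> + \<phi> (s * y))"
      using low[of "s * y"] s that by simp
    finally show ?thesis by (simp add: exp_add)
  qed
  then show ?thesis by (intro exI[of _ "exp (c * \<bar>T\<bar>)"]) auto
qed

text \<open>
The terms are bounded by a whole family of geometric sequences, one for each radius. The radius
\<open>\<beta> y\<close> gives ratio \<open>\<alpha> / \<beta> < 1\<close> and the factor \<open>exp (\<phi> (\<beta> * y))\<close>. For small \<open>y\<close> this radius is
not above 1; there the radius 2 serves instead, and costs the constant \<open>exp (\<phi> 2)\<close>.
\<close>

lemma sums_bounded_by_exp_weight:
  fixes \<phi> :: "real \<Rightarrow> real" and a :: "nat \<Rightarrow> complex"
  assumes nonneg: "\<And>t. t \<ge> 0 \<Longrightarrow> \<phi> t \<ge> 0"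
    and \<alpha>: "0 < \<alpha>" "\<alpha> < \<beta>" and y: "y \<ge> 0" and D: "D \<ge> 0"
    and a: "\<And>n r. r > 1 \<Longrightarrow> cmod (a n) \<le> D * exp (\<phi> r) * (\<alpha> * y / r) ^ n"
    and sums: "a sums S"
  shows "cmod S \<le> D * exp (\<phi> 2) / (1 - \<alpha> / \<beta>) * exp (\<phi> (\<beta> * y))"
proof -
  define r where "r = max (\<beta> * y) 2"
  have r: "r > 1" "r \<ge> \<beta> * y" by (auto simp: r_def)
  have q: "\<alpha> / \<beta> < 1" "0 \<le> \<alpha> / \<beta>" using \<alpha> by auto
  have "\<alpha> * (\<beta> * y) \<le> \<alpha> * r" using r \<alpha> by (intro mult_left_mono) auto
  then have ratio: "\<alpha> * y / r \<le> \<alpha> / \<beta>"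
    using r \<alpha> by (simp add: field_simps)
  have le: "cmod (a n) \<le> D * exp (\<phi> r) * (\<alpha> / \<beta>) ^ n" for n
  proof -
    note a[OF r(1), of n]
    also have "D * exp (\<phi> r) * (\<alpha> * y / r) ^ n \<le> D * exp (\<phi> r) * (\<alpha> / \<beta>) ^ n"
      using ratio D \<alpha> y r by (intro mult_left_mono power_mono) auto
    finally show ?thesis .
  qed
  have g: "(\<lambda>n. D * exp (\<phi> r) * (\<alpha> / \<beta>) ^ n) sums (D * exp (\<phi> r) * (1 / (1 - \<alpha> / \<beta>)))"
    using q by (intro sums_mult geometric_sums) auto
  have "cmod S \<le> D * exp (\<phi> r) * (1 / (1 - \<alpha> / \<beta>))"
    using norm_suminf_le[OF le sums_summable[OF g]] sums_unique[OF sums] sums_unique[OF g] by simp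
  also have "\<dots> \<le> D * exp (\<phi> 2 + \<phi> (\<beta> * y)) * (1 / (1 - \<alpha> / \<beta>))"
  proof -
    have "\<phi> r \<le> \<phi> 2 + \<phi> (\<beta> * y)"
      using nonneg[of 2] nonneg[of "\<beta> * y"] \<alpha> y by (auto simp: r_def max_def)
    then show ?thesis using D q by (intro mult_right_mono mult_left_mono) auto
  qed
  finally show ?thesis by (simp add: exp_add)
qed

section \<open>Extension to an element of the weighted space\<close>

theorem theorem2:
  fixes \<sigma> :: real and \<phi> :: "real \<Rightarrow> real" and f :: "real \<Rightarrow> complex"
  assumes "\<sigma> > 0"
    and "\<And>x. x \<ge> 0 \<Longrightarrow> \<phi> x \<ge> 0"
    and "mono_on {0..} \<phi>"
    and "continuous_on {0..} \<phi>"
    and "filterlim (\<lambda>x. \<phi> x / x) at_top at_top"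
    and "\<And>h. h > 1 \<Longrightarrow> \<exists>K>0. \<forall>x\<ge>0. 2 * \<phi> x \<le> \<phi> (h * x) + K"
    and "convex_on {0..} (\<lambda>x. \<phi> (exp x))"
    and "smooth f"
    and "\<And>\<epsilon> m. \<epsilon> > 0 \<Longrightarrow> \<exists>d>0. \<forall>n x.
           (1 + \<bar>x\<bar>) ^ m * cmod (nth_deriv n f x)
             \<le> d * (\<sigma> + \<epsilon>) ^ n * fact n * exp (- young_conjugate (\<lambda>y. \<phi> (exp y)) (real n))"
  shows "\<exists>F \<in> S_space \<sigma> \<phi>. (\<forall>x. F (complex_of_real x) = f x) \<and>
           (\<forall>G. G holomorphic_on UNIV \<and> (\<forall>x. G (complex_of_real x) = f x) \<longrightarrow> G = F)"
proof -
  note \<sigma> = assms(1) and nonneg = assms(2) and superlin = assms(5) and doubling = assms(6)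
    and f = assms(8) and decay = assms(9)
  \<comment> \<open>The constant \<open>d\<close> must not depend on \<open>r\<close>: the radius will be chosen according to \<open>Im z\<close>.\<close>
  have decay': "\<exists>d>0. \<forall>n x r. r > 1 \<longrightarrow> (1 + \<bar>x\<bar>) ^ m * cmod (nth_deriv n f x)
      \<le> d * (\<sigma> + \<epsilon>) ^ n * fact n * (exp (\<phi> r) / r ^ n)" if \<epsilon>: "\<epsilon> > 0" for \<epsilon> m
  proof -
    obtain d where d: "d > 0" "\<And>n x. (1 + \<bar>x\<bar>) ^ m * cmod (nth_deriv n f x)
      \<le> d * (\<sigma> + \<epsilon>) ^ n * fact n * exp (- young_conjugate (\<lambda>y. \<phi> (exp y)) (real n))"
      using decay[OF \<epsilon>] by blast
    have "(1 + \<bar>x\<bar>) ^ m * cmod (nth_deriv n f x) \<le> d * (\<sigma> + \<epsilon>) ^ n * fact n * (exp (\<phi> r) / r ^ n)"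
      if "r > 1" for n x r
      using d(1) \<sigma> \<epsilon> that
      by (intro order_trans[OF d(2)] mult_left_mono exp_minus_young_conjugate_le nonneg superlin) auto
    with d(1) show ?thesis by blast
  qed

  have "\<exists>C. \<forall>n x. cmod (nth_deriv n f x) * R ^ n \<le> C * fact n" if R: "R > 0" for R
  proof -
    \<comment> \<open>Any radius above \<open>(\<sigma> + 1) R\<close> and above 1 beats the growth of \<open>((\<sigma> + 1) R)\<^sup>n\<close>.\<close>
    define r where "r = (\<sigma> + 1) * R + 1"
    have r: "r > 1" using \<sigma> R by (simp add: r_def)
    obtain d where d: "d > 0" "\<And>n x. cmod (nth_deriv n f x)
        \<le> d * (\<sigma> + 1) ^ n * fact n * (exp (\<phi> r) / r ^ n)"
      using decay'[of 1 0] r by auto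
    define D where "D = d * exp (\<phi> r)"
    have D: "D > 0" using d(1) by (simp add: D_def)
    have "cmod (nth_deriv n f x) * R ^ n \<le> D * fact n" for n x
    proof -
      have "cmod (nth_deriv n f x) * R ^ n \<le> d * (\<sigma> + 1) ^ n * fact n * (exp (\<phi> r) / r ^ n) * R ^ n"
        using d(2) R by (intro mult_right_mono) auto
      also have "\<dots> = D * fact n * ((\<sigma> + 1) * R / r) ^ n"
        by (simp add: D_def power_mult_distrib power_divide)
      also have "\<dots> \<le> D * fact n * 1"
      proof -
        have "(\<sigma> + 1) * R / r \<le> 1" using r by (simp add: r_def divide_le_eq)
        then show ?thesis using D \<sigma> R r by (intro mult_left_mono power_le_one) auto
      qed
      finally show ?thesis by simp
    qed
    then show ?thesis by blast
  qed
  from smooth_entire_extension_with_Taylor_series[OF f this]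
  obtain F where F: "F holomorphic_on UNIV"
    and Taylor: "\<And>a z. (\<lambda>n. nth_deriv n f a / fact n * (z - complex_of_real a) ^ n) sums F z"
    by auto
  have ext: "F (complex_of_real x) = f x" for x
    using Taylor[of x "complex_of_real x"] powser_sums_zero[of "\<lambda>n. nth_deriv n f x / fact n"]
    by (auto simp: nth_deriv_0 dest: sums_unique2)

  have bounded: "\<exists>B. \<forall>z. cmod (F z) * (1 + cmod z) ^ k \<le> B * exp (\<phi> ((\<sigma> + \<epsilon>) * \<bar>Im z\<bar>))"
    if \<epsilon>: "\<epsilon> > 0" for \<epsilon> k
  proof -
    \<comment> \<open>The allowance \<open>\<epsilon>\<close> is spent in three stages: up to \<open>\<alpha>\<close> in the hypothesis on the derivatives,
      from \<open>\<alpha>\<close> to \<open>\<beta>\<close> to make the geometric series converge, and from \<open>\<beta>\<close> to \<open>\<sigma> + \<epsilon>\<close> in the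
      doubling condition.\<close>
    define \<alpha> where "\<alpha> = \<sigma> + \<epsilon> / 4"
    define \<beta> where "\<beta> = \<sigma> + \<epsilon> / 2"
    have \<alpha>\<beta>: "0 < \<alpha>" "\<alpha> < \<beta>" using \<sigma> \<epsilon> by (auto simp: \<alpha>_def \<beta>_def)
    obtain d where d: "d > 0" "\<And>n x r. r > 1 \<Longrightarrow> (1 + \<bar>x\<bar>) ^ k * cmod (nth_deriv n f x)
        \<le> d * \<alpha> ^ n * fact n * (exp (\<phi> r) / r ^ n)"
      using decay'[of "\<epsilon> / 4" k] \<epsilon> unfolding \<alpha>_def by auto
    obtain C where C: "C > 0" "\<And>y. y \<ge> 0 \<Longrightarrow> (1 + y) ^ k \<le> C * exp (\<phi> (\<beta> * y))"
      using power_le_exp_superlinear[of \<phi> \<beta> k] nonneg superlin \<alpha>\<beta> by auto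
    obtain K where K: "\<And>x. x \<ge> 0 \<Longrightarrow> 2 * \<phi> x \<le> \<phi> ((\<sigma> + \<epsilon>) / \<beta> * x) + K"
      using doubling[of "(\<sigma> + \<epsilon>) / \<beta>"] \<sigma> \<epsilon> by (auto simp: \<beta>_def)
    define A where "A = d * exp (\<phi> 2) / (1 - \<alpha> / \<beta>)"
    have A: "A \<ge> 0" using d(1) \<alpha>\<beta> by (simp add: A_def)
    have "cmod (F z) * (1 + cmod z) ^ k \<le> A * C * exp K * exp (\<phi> ((\<sigma> + \<epsilon>) * \<bar>Im z\<bar>))" for z
    proof -
      define x where "x = Re z"
      define y where "y = \<bar>Im z\<bar>"
      have y: "y \<ge> 0" by (simp add: y_def)
      define w where "w = (1 + \<bar>x\<bar>) ^ k"
      have w: "w \<ge> 0" by (simp add: w_def)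
      have zx: "z - complex_of_real x = \<i> * complex_of_real (Im z)"
        by (simp add: complex_eq_iff x_def)
      \<comment> \<open>The Taylor series at \<open>x = Re z\<close>, multiplied by the weight in \<open>x\<close>.\<close>
      have slice: "cmod (complex_of_real w * F z) \<le> A * exp (\<phi> (\<beta> * y))"
        unfolding A_def
      proof (rule sums_bounded_by_exp_weight[OF nonneg \<alpha>\<beta> y])
        show "(\<lambda>n. complex_of_real w * (nth_deriv n f x / fact n * (z - complex_of_real x) ^ n))
            sums (complex_of_real w * F z)"
          by (intro sums_mult Taylor)
        show "cmod (complex_of_real w * (nth_deriv n f x / fact n * (z - complex_of_real x) ^ n))
            \<le> d * exp (\<phi> r) * (\<alpha> * y / r) ^ n" if r: "r > 1" for n r
        proof -
          have "cmod (complex_of_real w * (nth_deriv n f x / fact n * (z - complex_of_real x) ^ n))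
              = w * cmod (nth_deriv n f x) / fact n * y ^ n"
            unfolding zx by (simp add: norm_mult norm_divide norm_power y_def w)
          also have "\<dots> \<le> d * \<alpha> ^ n * fact n * (exp (\<phi> r) / r ^ n) / fact n * y ^ n"
            using d(2)[OF r, of x n] y unfolding w_def by (intro mult_right_mono divide_right_mono) auto
          also have "\<dots> = d * exp (\<phi> r) * (\<alpha> * y / r) ^ n"
            by (simp add: power_mult_distrib power_divide)
          finally show ?thesis .
        qed
      qed (use d(1) in auto)
      have "1 + cmod z \<le> (1 + \<bar>x\<bar>) * (1 + y)"
      proof -
        have "cmod z \<le> \<bar>x\<bar> + y" unfolding x_def y_def by (rule cmod_le)
        moreover have "(1 + \<bar>x\<bar>) * (1 + y) = 1 + \<bar>x\<bar> + y + \<bar>x\<bar> * y" by (simp add: algebra_simps)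
        moreover have "\<bar>x\<bar> * y \<ge> 0" using y by simp
        ultimately show ?thesis by linarith
      qed
      then have "(1 + cmod z) ^ k \<le> w * (1 + y) ^ k"
        unfolding w_def power_mult_distrib[symmetric] by (intro power_mono) auto
      then have "cmod (F z) * (1 + cmod z) ^ k \<le> cmod (F z) * (w * (1 + y) ^ k)"
        by (rule mult_left_mono) simp
      also have "\<dots> = cmod (complex_of_real w * F z) * (1 + y) ^ k"
        by (simp add: norm_mult w)
      also have "\<dots> \<le> A * exp (\<phi> (\<beta> * y)) * (C * exp (\<phi> (\<beta> * y)))"
        using slice C(2)[OF y] A y by (intro mult_mono) auto
      also have "\<dots> = A * C * exp (2 * \<phi> (\<beta> * y))"
        by (simp add: exp_double power2_eq_square)
      also have "\<dots> \<le> A * C * exp (K + \<phi> ((\<sigma> + \<epsilon>) * y))"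
        using K[of "\<beta> * y"] A C(1) \<alpha>\<beta> y by (intro mult_left_mono) (auto simp: mult_ac)
      finally show ?thesis by (simp add: exp_add y_def)
    qed
    then show ?thesis by blast
  qed
  have growth: "weighted_norm \<sigma> \<phi> \<epsilon> k F < \<infinity>" if \<epsilon>: "\<epsilon> > 0" for \<epsilon> k
  proof -
    obtain B where "\<And>z. cmod (F z) * (1 + cmod z) ^ k \<le> B * exp (\<phi> ((\<sigma> + \<epsilon>) * \<bar>Im z\<bar>))"
      using bounded[OF \<epsilon>] by blast
    then have "weighted_norm \<sigma> \<phi> \<epsilon> k F \<le> ereal B"
      unfolding weighted_norm_def by (intro SUP_least) (simp add: pos_divide_le_eq)
    then show ?thesis by (rule le_less_trans) simp
  qed
  have "F \<in> S_space \<sigma> \<phi>"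
    using F growth by (simp add: S_space_def S_space_step_def)
  moreover have "G = F" if "G holomorphic_on UNIV" "\<And>x. G (complex_of_real x) = f x" for G
    using that F ext by (intro entire_eq_if_eq_on_reals) simp_all
  ultimately show ?thesis
    using ext by blast
qed

end
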